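(* Let $F:\mathbb{N}\to\mathbb{C}$ satisfy Wintner's Assumption $$\sum_{d=1}^{\infty}\frac{|F'(d)|}{d}<\infty .$$ Then for every $a\in\mathbb{N}$, $$F(a)=\lim_{P}\sum_{q\in (P)}\left(\mathrm{Win}_q F\right)c_q(a)=\lim_{P}\sum_{q\in (P)}\left(\mathrm{Car}_q F\right)c_q(a).$$ If, in addition, $\mathrm{supp}(\mathrm{Win}\,F)\subseteq (Q)$ for some prime $Q$, then for every $a\in\mathbb{N}$ $$F(a)=\sum_{q\in (Q)}\left(\mathrm{Win}_q F\right)c_q(a)=\sum_{q\in (Q)}\left(\mathrm{Car}_q F\right)c_q(a).$$ In particular, if there is $Q\in\mathbb{N}$ with $\mathrm{Win}_q F=0$ for all $q>Q$, then for every $a\in\mathbb{N}$ $$F(a)=\sum_{q\le Q}\left(\mathrm{Win}_q F\right)c_q(a)=\sum_{q\le Q}\left(\mathrm{Car}_q F\right)c_q(a).$$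
   Context: For $q,a\in\mathbb{N}$, $c_q(a)=\sum_{1\le j\le q,\,(j,q)=1}\cos(2\pi ja/q)$ is the Ramanujan sum. For $F:\mathbb{N}\to\mathbb{C}$, its Eratosthenes transform is $F'=F*\mu$, i.e. $F'(d)=\sum_{a\mid d}F(a)\mu(d/a)$, with $\mu$ the Möbius function. For $V\in\mathbb{N}$, $(V)$ denotes the set of $n\in\mathbb{N}$ having no prime factor $>V$ (so $1\in(V)$). The Wintner coefficients are $\mathrm{Win}_q F=\sum_{d\equiv 0 \bmod q}F'(d)/d$ (the series converging), and the Carmichael coefficients are $\mathrm{Car}_q F=\frac{1}{\varphi(q)}\lim_{x\to\infty}\frac1x\sum_{n\le x}F(n)c_q(n)$, $\varphi$ being Euler's totient; $\mathrm{Win}\,F$ denotes the function $q\mapsto \mathrm{Win}_qF$ and $\mathrm{supp}(G)=\{n: G(n)\ne 0\}$. $\lim_P$ denotes the limit as $P\to\infty$ through primes. *)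

theory Defs
  imports "HOL-Analysis.Analysis" "HOL-Computational_Algebra.Squarefree" "HOL-Number_Theory.Number_Theory"
begin

text \<open>Arithmetic functions on the positive integers are modelled as functions on \<^typ>\<open>nat\<close>; their
  value at 0 is never used.\<close>

definition moebius :: "nat \<Rightarrow> int" where
  "moebius n = (if squarefree n then (-1) ^ card (prime_factors n) else 0)"

definition ramanujan_sum :: "nat \<Rightarrow> nat \<Rightarrow> real" where
  "ramanujan_sum q a = (\<Sum>j\<in>{j\<in>{1..q}. coprime j q}. cos (2 * pi * real j * real a / real q))"

definition eratosthenes :: "(nat \<Rightarrow> complex) \<Rightarrow> nat \<Rightarrow> complex" where
  "eratosthenes F d = (\<Sum>a | a dvd d. F a * of_int (moebius (d div a)))"

definition smooth_numbers :: "nat \<Rightarrow> nat set" where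
  "smooth_numbers V = {n. n > 0 \<and> (\<forall>p. prime p \<longrightarrow> p dvd n \<longrightarrow> p \<le> V)}"

definition support :: "(nat \<Rightarrow> complex) \<Rightarrow> nat set" where
  "support G = {n. n > 0 \<and> G n \<noteq> 0}"

definition wintner_term :: "(nat \<Rightarrow> complex) \<Rightarrow> nat \<Rightarrow> nat \<Rightarrow> complex" where
  "wintner_term F q d = (if d > 0 \<and> q dvd d then eratosthenes F d / of_nat d else 0)"

text \<open>The series over the multiples of \<open>q\<close> is taken in increasing order of \<open>d\<close>. The value is
  meaningful only if it converges.\<close>

definition Win :: "(nat \<Rightarrow> complex) \<Rightarrow> nat \<Rightarrow> complex" where
  "Win F q = (\<Sum>d. wintner_term F q d)"

definition carmichael_mean :: "(nat \<Rightarrow> complex) \<Rightarrow> nat \<Rightarrow> real \<Rightarrow> complex" where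
  "carmichael_mean F q x =
     (\<Sum>n | n > 0 \<and> real n \<le> x. F n * of_real (ramanujan_sum q n)) / of_real x"

text \<open>The value is meaningful only if the limit exists.\<close>

definition Car :: "(nat \<Rightarrow> complex) \<Rightarrow> nat \<Rightarrow> complex" where
  "Car F q = Lim at_top (carmichael_mean F q) / of_nat (totient q)"

definition primes_at_top :: "nat filter" where
  "primes_at_top = inf at_top (principal {P. prime P})"

end

theory Submission
  imports Defs
begin

text \<open>
  Write \<open>F'\<close> for the Eratosthenes transform. Summing \<open>F n = (\<Sum>d dvd n. F' d)\<close> against \<open>c\<^sub>q\<close>, the mean
  over the multiples of \<open>d\<close> of \<open>c\<^sub>q\<close> is \<open>\<phi>(q) / d\<close> if \<open>q\<close> divides \<open>d\<close> and \<open>0\<close> otherwise, so dominated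
  convergence for series (Tannery) identifies the Carmichael with the Wintner coefficients.

  For fixed \<open>a\<close> and \<open>V\<close>, only finitely many \<open>V\<close>-smooth \<open>q\<close> have \<open>c\<^sub>q(a) \<noteq> 0\<close>. Hence the smooth partial
  sum equals \<open>\<Sum>d. F' d / d * C\<^sub>V(d)\<close>, where \<open>C\<^sub>V(d)\<close> is the sum of \<open>c\<^sub>q(a)\<close> over the divisors \<open>q\<close> of the
  \<open>V\<close>-smooth part \<open>s\<close> of \<open>d\<close>. This is \<open>s\<close> if \<open>s\<close> divides \<open>a\<close> and \<open>0\<close> otherwise: it is bounded by \<open>a\<close>, and
  for \<open>V \<ge> d\<close> it no longer depends on \<open>V\<close>. Tannery's theorem again gives the limit
  \<open>(\<Sum>d dvd a. F' d) = F a\<close>. Under either support condition the smooth sums are eventually constant.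
\<close>

section \<open>Moebius inversion for the Eratosthenes transform\<close>

lemma moebius_prime_mult:
  assumes "prime p" "\<not> p dvd d"
  shows "moebius (p * d) = - moebius d"
proof -
  have cop: "coprime p d"
    using assms by (simp add: prime_imp_coprime)
  have d0: "d \<noteq> 0" and p0: "p \<noteq> 0"
    using assms by (metis dvd_0_right, metis not_prime_0)
  have sqf: "squarefree (p * d) \<longleftrightarrow> squarefree d"
    using cop assms(1) by (auto intro: squarefree_mult_coprime squarefree_prime dest: squarefree_multD)
  have "prime_factors (p * d) = insert p (prime_factors d)"
    using assms d0 p0 by (simp add: prime_factors_product prime_factorization_prime)
  moreover have "p \<notin> prime_factors d"
    using assms by (auto simp: prime_factors_dvd)
  ultimately show ?thesis
    by (simp add: moebius_def sqf)
qed

text \<open>Fix a prime \<open>p\<close> dividing \<open>n\<close>. Each divisor \<open>d\<close>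
  prime to \<open>p\<close> cancels against \<open>p * d\<close>. The divisors left over are
  multiples of \<open>p ^ 2\<close>, where \<open>moebius\<close> vanishes.\<close>

lemma sum_moebius_divisors:
  assumes "n > 0"
  shows "(\<Sum>d | d dvd n. moebius d) = (if n = 1 then 1 else 0)"
proof (cases "n = 1")
  case True
  then show ?thesis by (simp add: moebius_def)
next
  case False
  then obtain p where p: "prime p" "p dvd n"
    using prime_factor_nat by blast
  define A where "A = {d. d dvd n \<and> \<not> p dvd d}"
  define B where "B = {d. d dvd n \<and> p dvd d}"
  have fin: "finite {d. d dvd n}"
    using assms by (simp add: finite_divisors_nat)
  have finAB: "finite A" "finite B"
    by (auto intro: finite_subset[OF _ fin] simp: A_def B_def)
  have AB: "{d. d dvd n} = A \<union> B" "A \<inter> B = {}"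
    by (auto simp: A_def B_def)
  have pA: "(\<lambda>d. p * d) ` A \<subseteq> B"
    using p by (auto simp: A_def B_def intro!: divides_mult prime_imp_coprime)
  have "(\<Sum>d\<in>B. moebius d) = (\<Sum>d\<in>(\<lambda>d. p * d) ` A. moebius d)"
  proof (rule sum.mono_neutral_right[OF finAB(2) pA], safe)
    fix d assume d: "d \<in> B" "d \<notin> (\<lambda>d. p * d) ` A"
    then obtain e where e: "d = p * e"
      by (auto simp: B_def)
    have "e dvd n"
      using d(1) dvd_mult_right unfolding B_def e by blast
    with d e have "p dvd e"
      by (auto simp: A_def)
    then have "p ^ 2 dvd d"
      by (auto simp: e power2_eq_square)
    then have "\<not> squarefree d"
      using p(1) not_prime_unit squarefreeD by blast
    then show "moebius d = 0"
      by (simp add: moebius_def)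
  qed
  also have "\<dots> = (\<Sum>d\<in>A. moebius (p * d))"
    using p(1) by (subst sum.reindex) (auto simp: inj_on_def prime_gt_0_nat)
  also have "\<dots> = (\<Sum>d\<in>A. - moebius d)"
    by (rule sum.cong) (auto simp: A_def moebius_prime_mult p)
  finally show ?thesis
    using False finAB AB by (simp add: sum.union_disjoint sum_negf)
qed

text \<open>Swapping the two divisor sums and writing \<open>d = a * e\<close> leaves the
  coefficient of \<open>F a\<close> as the sum of \<open>moebius\<close> over the divisors of
  \<open>n div a\<close>, which is nonzero only for \<open>a = n\<close>.\<close>

lemma sum_eratosthenes:
  assumes "n > 0"
  shows "(\<Sum>d | d dvd n. eratosthenes F d) = F n"
proof -
  have fin: "finite {d. d dvd m}" if "m > 0" for m :: nat
    using that by (simp add: finite_divisors_nat)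
  have "(\<Sum>d | d dvd n. eratosthenes F d)
      = (\<Sum>d | d dvd n. \<Sum>a | a dvd n \<and> a dvd d. F a * of_int (moebius (d div a)))"
    unfolding eratosthenes_def by (intro sum.cong) (auto intro: dvd_trans)
  also have "\<dots> = (\<Sum>a | a dvd n. \<Sum>d | d dvd n \<and> a dvd d. F a * of_int (moebius (d div a)))"
    using sum.swap_restrict[OF fin[OF assms] fin[OF assms],
        where g = "\<lambda>d a. F a * of_int (moebius (d div a))" and R = "\<lambda>d a. a dvd d"] by simp
  also have "\<dots> = (\<Sum>a | a dvd n. F a * of_int (\<Sum>e | e dvd n div a. moebius e))"
  proof (rule sum.cong[OF refl], clarify)
    fix a assume "a dvd n"
    then obtain b where b: "n = a * b" ..
    with assms have pos: "a > 0" "b > 0"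
      by auto
    have "(\<Sum>d | d dvd n \<and> a dvd d. F a * of_int (moebius (d div a)))
        = (\<Sum>e | e dvd b. F a * of_int (moebius e))"
      by (rule sum.reindex_bij_witness[of _ "\<lambda>e. a * e" "\<lambda>d. d div a"]) (use pos b in auto)
    then show "(\<Sum>d | d dvd n \<and> a dvd d. F a * of_int (moebius (d div a)))
        = F a * of_int (\<Sum>e | e dvd n div a. moebius e)"
      using pos b by (simp add: sum_distrib_left)
  qed
  also have "\<dots> = (\<Sum>a | a dvd n. if a = n then F a else 0)"
  proof (rule sum.cong[OF refl], clarify)
    fix a assume "a dvd n"
    then obtain b where b: "n = a * b" ..
    with assms have "a > 0" "b > 0"
      by auto
    with b show "F a * of_int (\<Sum>e | e dvd n div a. moebius e) = (if a = n then F a else 0)"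
      by (simp add: sum_moebius_divisors)
  qed
  also have "\<dots> = F n"
    using fin[OF assms] by simp
  finally show ?thesis .
qed

text \<open>Strong induction: once \<open>g\<close> and \<open>h\<close> agree on the proper
  divisors of \<open>n\<close>, subtracting these from the two equal divisor sums isolates the value
  at \<open>n\<close>. This gives the uniqueness in Moebius inversion.\<close>

lemma eqI_sum_divisors:
  fixes g h :: "nat \<Rightarrow> 'a::ab_group_add"
  assumes "\<And>m. m > 0 \<Longrightarrow> (\<Sum>d | d dvd m. g d) = (\<Sum>d | d dvd m. h d)" and "n > 0"
  shows "g n = h n"
  using \<open>n > 0\<close>
proof (induction n rule: less_induct)
  case (less n)
  have fin: "finite {d. d dvd n}"
    using less.prems by (simp add: finite_divisors_nat)
  have "(\<Sum>d\<in>{d. d dvd n} - {n}. g d) = (\<Sum>d\<in>{d. d dvd n} - {n}. h d)"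
  proof (rule sum.cong[OF refl])
    fix d assume d: "d \<in> {d. d dvd n} - {n}"
    then have "d > 0"
      using less.prems by (auto intro: dvd_pos_nat)
    moreover have "d < n"
      using d dvd_imp_le[of d n] less.prems by auto
    ultimately show "g d = h d"
      by (rule less.IH[rotated])
  qed
  with assms(1)[OF less.prems] show ?case
    using fin by (simp add: sum.remove[of _ n])
qed

lemma eratosthenes_eqI:
  assumes "\<And>m. m > 0 \<Longrightarrow> (\<Sum>d | d dvd m. g d) = G m" and "n > 0"
  shows "eratosthenes G n = g n"
  by (rule eqI_sum_divisors) (use assms in \<open>simp_all add: sum_eratosthenes\<close>)

section \<open>Roots of unity and divisor sums of Ramanujan sums\<close>

lemma cis_eq_1_iff_dvd:
  assumes "q > 0"
  shows "cis (2 * pi * real b / real q) = 1 \<longleftrightarrow> q dvd b"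
proof
  assume "q dvd b"
  then obtain c where "b = q * c" ..
  then have "2 * pi * real b / real q = 2 * pi * real c"
    using assms by simp
  then show "cis (2 * pi * real b / real q) = 1"
    by (simp add: cis_multiple_2pi)
next
  assume "cis (2 * pi * real b / real q) = 1"
  then have "cos (2 * pi * real b / real q) = 1"
    by (metis cis.sel(1) one_complex.sel(1))
  then obtain k :: int where "2 * pi * real b / real q = real_of_int k * 2 * pi"
    using cos_one_2pi_int by auto
  then have "real b = real_of_int k * real q"
    using assms by (simp add: field_simps)
  then have "int b = k * int q"
    by (metis of_int_eq_iff of_int_mult of_int_of_nat_eq)
  then show "q dvd b"
    by (metis dvd_triv_right int_dvd_int_iff)
qed

text \<open>The cosines are real parts of the powers of an \<open>n\<close>-th root of unity
  \<open>z\<close>, whose geometric sum vanishes unless \<open>z = 1\<close>.\<close>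

lemma cos_sum_full_period:
  assumes "n > 0"
  shows "(\<Sum>j=1..n. cos (2 * pi * real j * real a / real n)) = (if n dvd a then real n else 0)"
proof -
  define z where "z = cis (2 * pi * real a / real n)"
  have z_pow: "z ^ j = cis (2 * pi * real j * real a / real n)" for j
    unfolding z_def Complex.DeMoivre by (rule arg_cong[where f = cis]) simp
  have zj: "cos (2 * pi * real j * real a / real n) = Re (z ^ j)" for j
    unfolding z_pow cis.sel ..
  have zn: "z ^ n = 1"
    using cis_eq_1_iff_dvd[OF assms, of "n * a"] by (simp add: z_pow mult_ac)
  have "(\<Sum>j=1..n. z ^ j) = (if n dvd a then of_nat n else 0)"
  proof (cases "z = 1")
    case True
    then show ?thesis
      using cis_eq_1_iff_dvd[OF assms, of a] by (simp add: z_def)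
  next
    case False
    have "(\<Sum>j=1..n. z ^ j) = 0"
      using assms zn False by (simp add: sum_gp)
    then show ?thesis
      using False cis_eq_1_iff_dvd[OF assms, of a] by (simp add: z_def)
  qed
  then have "Re (\<Sum>j=1..n. z ^ j) = (if n dvd a then real n else 0)"
    by simp
  then show ?thesis
    by (simp add: zj)
qed

lemma ramanujan_sum_totatives:
  "ramanujan_sum q a = (\<Sum>j\<in>totatives q. cos (2 * pi * real j * real a / real q))"
  unfolding ramanujan_sum_def totatives_def by (rule sum.cong) auto

text \<open>Sorting \<open>k\<close> in \<open>{1..n}\<close> by \<open>d = gcd k n\<close> reduces
  \<open>k / n\<close> to a fraction in lowest terms with denominator \<open>n div d\<close>, so the
  Ramanujan sums together run over one full period.\<close>

lemma sum_ramanujan_sum_divisors: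
  assumes n: "n > 0"
  shows "(\<Sum>q | q dvd n. ramanujan_sum q a) = (if n dvd a then real n else 0)"
proof -
  define A where "A = (\<lambda>d. {k\<in>{0<..n}. gcd k n = d})"
  let ?c = "\<lambda>k. cos (2 * pi * real k * real a / real n)"
  have "(\<Sum>q | q dvd n. ramanujan_sum q a) = (\<Sum>d | d dvd n. ramanujan_sum (n div d) a)"
    using n by (intro sum.reindex_bij_witness[of _ "(div) n" "(div) n"]) (auto elim: dvdE)
  also have "\<dots> = (\<Sum>d | d dvd n. \<Sum>k\<in>A d. ?c k)"
  proof (rule sum.cong[OF refl], clarify)
    fix d assume d: "d dvd n"
    then obtain e where e: "n = d * e" ..
    have "(\<Sum>k\<in>A d. ?c k) = (\<Sum>k\<in>totatives (n div d). ?c (k * d))"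
      unfolding A_def by (rule sum.reindex_bij_betw[OF bij_betw_totatives_gcd_eq[OF d n], symmetric])
    also have "\<dots> = ramanujan_sum (n div d) a"
      unfolding ramanujan_sum_totatives using n e by (intro sum.cong) (auto simp: mult_ac)
    finally show "ramanujan_sum (n div d) a = (\<Sum>k\<in>A d. ?c k)" ..
  qed
  also have "\<dots> = sum ?c (\<Union>d\<in>{d. d dvd n}. A d)"
    using n by (intro sum.UNION_disjoint[symmetric]) (auto simp: A_def)
  also have "(\<Union>d\<in>{d. d dvd n}. A d) = {1..n}"
    by (auto simp: A_def)
  finally show ?thesis
    using cos_sum_full_period[OF n, of a] by simp
qed

text \<open>The divisor sums over \<open>q\<close> are known, and they determine the summand.
  Unfolded, this is Kluyver's formula: \<open>ramanujan_sum q a\<close> is the sum of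
  \<open>e * moebius (q div e)\<close> over the common divisors \<open>e\<close> of \<open>q\<close>
  and \<open>a\<close>.\<close>

lemma ramanujan_sum_eq_eratosthenes:
  assumes "q > 0"
  shows "complex_of_real (ramanujan_sum q a)
       = eratosthenes (\<lambda>n. if n dvd a then of_nat n else 0) q"
proof (rule eratosthenes_eqI[symmetric, OF _ assms])
  fix m :: nat assume "m > 0"
  then show "(\<Sum>d | d dvd m. complex_of_real (ramanujan_sum d a)) = (if m dvd a then of_nat m else 0)"
    by (simp add: sum_ramanujan_sum_divisors flip: of_real_sum)
qed

section \<open>Ramanujan sums over smooth numbers\<close>

lemma squarefree_smooth_dvd_fact:
  assumes "squarefree n" "n \<in> smooth_numbers V"
  shows "n dvd fact V"
proof -
  have "n = (\<Prod>p\<in>prime_factors n. p ^ multiplicity p n)"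
    using assms by (simp add: smooth_numbers_def prime_factorization_nat)
  also have "\<dots> = \<Prod>(prime_factors n)"
  proof (rule prod.cong[OF refl])
    fix p assume p: "p \<in> prime_factors n"
    have "n \<noteq> 0"
      using assms(1) by (metis not_squarefree_0)
    then have "multiplicity p n \<le> 1"
      using assms(1) p squarefree_factorial_semiring''[of n] by (auto simp: prime_factors_dvd)
    moreover have "multiplicity p n > 0"
      using p by (simp add: prime_factors_multiplicity)
    ultimately have "multiplicity p n = 1"
      by simp
    then show "p ^ multiplicity p n = p"
      by simp
  qed
  \<comment> \<open>By smoothness the prime factors form a subset of \<open>{1..V}\<close>, so their
    product is a subproduct of the factorial.\<close>
  also have "\<dots> dvd \<Prod>{1..V}"
    using assms(2) by (intro prod_dvd_prod_subset)
      (auto simp: smooth_numbers_def prime_factors_dvd prime_gt_0_nat Suc_leI)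
  also have "\<dots> = fact V"
    by (simp add: fact_prod)
  finally show ?thesis .
qed

text \<open>If the sum is nonzero, Kluyver's formula has a nonzero term: some \<open>e\<close>
  divides \<open>a\<close> and \<open>q\<close> with \<open>q div e\<close> squarefree. As
  \<open>q div e\<close> is also \<open>V\<close>-smooth, it divides \<open>fact V\<close>, which
  confines \<open>q\<close> to the divisors of \<open>a * fact V\<close>.\<close>

lemma finite_smooth_ramanujan_sum_nonzero:
  assumes "a > 0"
  shows "finite {q \<in> smooth_numbers V. ramanujan_sum q a \<noteq> 0}"
proof (rule finite_subset)
  show "{q \<in> smooth_numbers V. ramanujan_sum q a \<noteq> 0} \<subseteq> {q. q dvd a * fact V}"
  proof clarify
    fix q assume q: "q \<in> smooth_numbers V" "ramanujan_sum q a \<noteq> 0"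
    then have "q > 0"
      by (simp add: smooth_numbers_def)
    with q have "eratosthenes (\<lambda>n. if n dvd a then of_nat n else 0) q \<noteq> 0"
      using ramanujan_sum_eq_eratosthenes[of q a] by auto
    then obtain e where e: "e dvd q" "e dvd a" "moebius (q div e) \<noteq> 0"
      unfolding eratosthenes_def by (auto elim!: sum.not_neutral_contains_not_neutral split: if_splits)
    then have sqf: "squarefree (q div e)"
      by (auto simp: moebius_def split: if_splits)
    have "q div e \<in> smooth_numbers V"
      using q(1) e(1) by (auto simp: smooth_numbers_def elim!: dvdE)
    with sqf have "q div e dvd fact V"
      by (rule squarefree_smooth_dvd_fact)
    with e have "e * (q div e) dvd a * fact V"
      by (intro mult_dvd_mono)
    with e(1) show "q dvd a * fact V"
      by simp
  qed
  show "finite {q. q dvd a * fact V}"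
    using assms by (simp add: finite_divisors_nat)
qed

text \<open>The witness \<open>s\<close> is the \<open>V\<close>-smooth part of \<open>d\<close>,
  obtained as the least common multiple of all smooth divisors. It is itself smooth because a prime
  dividing \<open>lcm x y\<close> divides \<open>x * y\<close>, hence \<open>x\<close> or
  \<open>y\<close>.\<close>

lemma smooth_divisors_eq_divisors:
  assumes "d > 0"
  obtains s where "s > 0" "{q \<in> smooth_numbers V. q dvd d} = {q. q dvd s}"
proof
  define A where "A = {q \<in> smooth_numbers V. q dvd d}"
  have fin: "finite A"
    using assms by (auto simp: A_def intro: finite_subset[OF _ finite_divisors_nat])
  have "Lcm B \<in> smooth_numbers V" if "B \<subseteq> A" for B
    using finite_subset[OF that fin] that
  proof (induction B rule: finite_induct)
    case empty
    then show ?case by (simp add: smooth_numbers_def)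
  next
    case (insert x B)
    have x: "x \<in> smooth_numbers V" and B: "Lcm B \<in> smooth_numbers V"
      using insert by (auto simp: A_def)
    have "p \<le> V" if p: "prime p" "p dvd lcm x (Lcm B)" for p
    proof -
      have "lcm x (Lcm B) dvd x * Lcm B"
        by (rule lcm_least) simp_all
      with p have "p dvd x \<or> p dvd Lcm B"
        using dvd_trans prime_dvd_mult_iff by blast
      with p(1) x B show ?thesis
        by (auto simp: smooth_numbers_def)
    qed
    moreover have "lcm x (Lcm B) > 0"
      using x B by (simp add: smooth_numbers_def lcm_pos_nat)
    ultimately show ?case
      by (simp add: smooth_numbers_def)
  qed
  then have smooth: "Lcm A \<in> smooth_numbers V"
    by simp
  then show "Lcm A > 0"
    by (simp add: smooth_numbers_def)
  have "Lcm A dvd d"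
    by (rule Lcm_least) (simp add: A_def)
  have "A = {q. q dvd Lcm A}"
  proof (intro equalityI subsetI CollectI)
    fix q assume "q \<in> A"
    then show "q dvd Lcm A"
      by (rule dvd_Lcm)
  next
    fix q assume "q \<in> {q. q dvd Lcm A}"
    then have q: "q dvd Lcm A"
      by simp
    then have "q > 0" "\<And>p. p dvd q \<Longrightarrow> p dvd Lcm A"
      using smooth by (auto simp: smooth_numbers_def intro: dvd_pos_nat dvd_trans)
    with smooth have "q \<in> smooth_numbers V"
      unfolding smooth_numbers_def by blast
    moreover have "q dvd d"
      using q \<open>Lcm A dvd d\<close> by (rule dvd_trans)
    ultimately show "q \<in> A"
      unfolding A_def by blast
  qed
  then show "{q \<in> smooth_numbers V. q dvd d} = {q. q dvd Lcm A}"
    by (simp add: A_def)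
qed

text \<open>The sum is \<open>s\<close> or 0, and it is \<open>s\<close> only when \<open>s\<close>
  divides \<open>a\<close>. Uniformity in \<open>V\<close> and \<open>d\<close> is what makes this a
  dominating bound later.\<close>

lemma norm_sum_smooth_ramanujan_sum_le:
  assumes "a > 0" "d > 0"
  shows "\<bar>\<Sum>q | q \<in> smooth_numbers V \<and> q dvd d. ramanujan_sum q a\<bar> \<le> real a"
proof -
  obtain s where s: "s > 0" "{q \<in> smooth_numbers V. q dvd d} = {q. q dvd s}"
    using smooth_divisors_eq_divisors[OF assms(2)] .
  then show ?thesis
    using assms(1) by (auto simp: sum_ramanujan_sum_divisors dest: dvd_imp_le)
qed

text \<open>Prime factors of a divisor of \<open>d\<close> are at most \<open>d\<close>, so for
  \<open>V >= d\<close> smoothness is no restriction.\<close>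

lemma sum_smooth_ramanujan_sum_eq:
  assumes "d > 0" "d \<le> V"
  shows "(\<Sum>q | q \<in> smooth_numbers V \<and> q dvd d. ramanujan_sum q a) = (if d dvd a then real d else 0)"
proof -
  have "{q. q \<in> smooth_numbers V \<and> q dvd d} = {q. q dvd d}"
    using assms by (auto simp: smooth_numbers_def intro: dvd_pos_nat)
      (meson dvd_imp_le dvd_trans le_trans)
  then show ?thesis
    using assms by (simp add: sum_ramanujan_sum_divisors)
qed


section \<open>Means of Ramanujan sums along multiples\<close>

lemma mean_cos_tendsto:
  assumes "q > 0"
  shows "(\<lambda>N. (\<Sum>m=1..N. cos (2 * pi * real m * real b / real q)) / real N)
           \<longlonglongrightarrow> (if q dvd b then 1 else 0)"
proof -
  define z where "z = cis (2 * pi * real b / real q)"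
  have z_pow: "z ^ m = cis (2 * pi * real m * real b / real q)" for m
    unfolding z_def Complex.DeMoivre by (rule arg_cong[where f = cis]) simp
  have zm: "cos (2 * pi * real m * real b / real q) = Re (z ^ m)" for m
    unfolding z_pow cis.sel ..
  have z1: "z = 1 \<longleftrightarrow> q dvd b"
    unfolding z_def by (rule cis_eq_1_iff_dvd[OF assms])
  have "(\<lambda>N. (\<Sum>m=1..N. z ^ m) / of_nat N) \<longlonglongrightarrow> (if z = 1 then 1 else 0)"
  proof (cases "z = 1")
    case True
    have "\<forall>\<^sub>F N in sequentially. (\<Sum>m=1..N. z ^ m) / of_nat N = 1"
      using eventually_gt_at_top[of 0] by eventually_elim (simp add: True)
    then show ?thesis
      using True by (simp add: tendsto_eventually)
  next
    case False
    \<comment> \<open>For \<open>z\<close> different from 1 the geometric sums stay bounded, the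
      numerator \<open>z - z ^ Suc N\<close> having norm at most 2. Hence the means tend to
      0.\<close>
    have bound: "norm ((\<Sum>m=1..N. z ^ m) / of_nat N) \<le> (2 / norm (1 - z)) / real N" for N
    proof -
      have norm_z: "norm z = 1"
        by (simp add: z_def)
      have "norm (\<Sum>m=1..N. z ^ m) \<le> 2 / norm (1 - z)"
      proof (cases "N = 0")
        case False
        then have "(\<Sum>m=1..N. z ^ m) = (z - z ^ Suc N) / (1 - z)"
          using \<open>z \<noteq> 1\<close> by (simp add: sum_gp)
        moreover have "norm (z - z ^ Suc N) \<le> 2"
          using norm_triangle_ineq4[of z "z ^ Suc N"] by (simp add: norm_power norm_mult norm_z)
        ultimately show ?thesis
          by (simp add: norm_divide divide_right_mono)
      qed auto
      then have "norm (\<Sum>m=1..N. z ^ m) / real N \<le> (2 / norm (1 - z)) / real N"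
        by (rule divide_right_mono) simp
      then show ?thesis
        by (simp only: norm_divide norm_of_nat)
    qed
    have "(\<lambda>N. (2 / norm (1 - z)) / real N) \<longlonglongrightarrow> 0"
      by (rule lim_const_over_n)
    then have "(\<lambda>N. (\<Sum>m=1..N. z ^ m) / of_nat N) \<longlonglongrightarrow> 0"
      by (rule Lim_null_comparison[OF always_eventually[OF allI[OF bound]]])
    with False show ?thesis
      by simp
  qed
  then have "(\<lambda>N. Re ((\<Sum>m=1..N. z ^ m) / of_nat N)) \<longlonglongrightarrow> Re (if z = 1 then 1 else 0)"
    by (rule tendsto_Re)
  then show ?thesis
    by (simp add: zm z1 if_distrib[of Re] Re_divide_of_nat cong: if_cong)
qed

lemma abs_ramanujan_sum_le: "\<bar>ramanujan_sum q a\<bar> \<le> real (totient q)"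
proof -
  have "\<bar>ramanujan_sum q a\<bar> \<le> (\<Sum>j\<in>totatives q. \<bar>cos (2 * pi * real j * real a / real q)\<bar>)"
    unfolding ramanujan_sum_totatives by (rule sum_abs)
  also have "\<dots> \<le> (\<Sum>j\<in>totatives q. 1)"
    by (rule sum_mono) (rule abs_cos_le_one)
  finally show ?thesis
    by (simp add: totient_def)
qed

lemma mean_ramanujan_sum_tendsto:
  assumes "q > 0"
  shows "(\<lambda>N. (\<Sum>m=1..N. ramanujan_sum q (d * m)) / real N)
           \<longlonglongrightarrow> (if q dvd d then real (totient q) else 0)"
proof -
  have "(\<lambda>N. \<Sum>j\<in>totatives q. (\<Sum>m=1..N. cos (2 * pi * real m * real (j * d) / real q)) / real N)
          \<longlonglongrightarrow> (\<Sum>j\<in>totatives q. if q dvd j * d then 1 else 0)"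
    by (intro tendsto_sum mean_cos_tendsto assms)
  also have "(\<Sum>j\<in>totatives q. if q dvd j * d then 1 else 0)
      = (\<Sum>j\<in>totatives q. if q dvd d then 1 else 0 :: real)"
    \<comment> \<open>Since \<open>j\<close> is coprime to \<open>q\<close>, \<open>q\<close>
      divides \<open>j * d\<close> exactly when it divides \<open>d\<close>, so all totatives
      contribute the same limit.\<close>
    by (intro sum.cong refl)
      (auto simp: in_totatives_iff coprime_commute coprime_dvd_mult_right_iff)
  also have "\<dots> = (if q dvd d then real (totient q) else 0)"
    by (simp add: totient_def)
  also have "(\<lambda>N. \<Sum>j\<in>totatives q. (\<Sum>m=1..N. cos (2 * pi * real m * real (j * d) / real q)) / real N)
      = (\<lambda>N. (\<Sum>m=1..N. ramanujan_sum q (d * m)) / real N)"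
  proof
    fix N
    have "(\<Sum>m=1..N. ramanujan_sum q (d * m))
        = (\<Sum>m=1..N. \<Sum>j\<in>totatives q. cos (2 * pi * real m * real (j * d) / real q))"
      unfolding ramanujan_sum_totatives by (simp add: mult_ac)
    also have "\<dots> = (\<Sum>j\<in>totatives q. \<Sum>m=1..N. cos (2 * pi * real m * real (j * d) / real q))"
      by (rule sum.swap)
    finally show "(\<Sum>j\<in>totatives q. (\<Sum>m=1..N. cos (2 * pi * real m * real (j * d) / real q)) / real N)
        = (\<Sum>m=1..N. ramanujan_sum q (d * m)) / real N"
      by (simp add: sum_divide_distrib)
  qed
  finally show ?thesis .
qed

lemma real_div_over_tendsto:
  assumes "d > 0"
  shows "(\<lambda>N. real (N div d) / real N) \<longlonglongrightarrow> 1 / real d"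
proof (rule tendsto_sandwich)
  show "\<forall>\<^sub>F N in sequentially. 1 / real d - 1 / real N \<le> real (N div d) / real N"
    using eventually_gt_at_top[of 0]
  proof eventually_elim
    case (elim N)
    have "real N / real d - 1 \<le> real (N div d)"
      using floor_divide_of_nat_eq[of N d, where ?'a = real] by linarith
    then have "(real N / real d - 1) / real N \<le> real (N div d) / real N"
      by (rule divide_right_mono) simp
    with elim show ?case
      by (simp add: diff_divide_distrib)
  qed
  show "\<forall>\<^sub>F N in sequentially. real (N div d) / real N \<le> 1 / real d"
    using eventually_gt_at_top[of 0]
  proof eventually_elim
    case (elim N)
    have "real (N div d) / real N \<le> (real N / real d) / real N"
      using of_nat_div_le_of_nat[of N d, where ?'a = real] by (rule divide_right_mono) simp
    with elim show ?case
      by simp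
  qed
  show "(\<lambda>N. 1 / real d - 1 / real N) \<longlonglongrightarrow> 1 / real d"
    using tendsto_diff[OF tendsto_const lim_const_over_n[of 1]] by simp
qed simp

text \<open>Split off the mean over the \<open>N div d\<close> multiples; the remaining factor
  \<open>(N div d) / N\<close> tends to \<open>1 / d\<close>.\<close>

lemma mean_ramanujan_sum_multiples_tendsto:
  assumes "q > 0" "d > 0"
  shows "(\<lambda>N. (\<Sum>m=1..N div d. ramanujan_sum q (d * m)) / real N)
           \<longlonglongrightarrow> (if q dvd d then real (totient q) / real d else 0)"
proof -
  define S where "S = (\<lambda>N. \<Sum>m=1..N. ramanujan_sum q (d * m))"
  have "filterlim (\<lambda>N. N div d) at_top sequentially"
    using assms(2) by (rule filterlim_at_top_div_const_nat)
  then have "(\<lambda>N. S (N div d) / real (N div d)) \<longlonglongrightarrow> (if q dvd d then real (totient q) else 0)"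
    unfolding S_def by (rule filterlim_compose[OF mean_ramanujan_sum_tendsto[OF assms(1)]])
  then have "(\<lambda>N. S (N div d) / real (N div d) * (real (N div d) / real N))
      \<longlonglongrightarrow> (if q dvd d then real (totient q) else 0) * (1 / real d)"
    by (intro tendsto_mult real_div_over_tendsto assms)
  \<comment> \<open>For \<open>N < d\<close> both sides are 0, because the sum \<open>S 0\<close> is
    empty.\<close>
  moreover have "S (N div d) / real (N div d) * (real (N div d) / real N) = S (N div d) / real N" for N
    by (cases "N div d = 0") (simp_all add: S_def)
  ultimately have "(\<lambda>N. S (N div d) / real N)
      \<longlonglongrightarrow> (if q dvd d then real (totient q) else 0) * (1 / real d)"
    by (simp only:)
  then show ?thesis
    unfolding S_def by (cases "q dvd d") simp_all
qed

section \<open>Carmichael means as series in the Eratosthenes transform\<close>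

lemma sum_eratosthenes_multiples:
  "(\<Sum>n=1..N. F n * g n) = (\<Sum>d=1..N. eratosthenes F d * (\<Sum>m=1..N div d. g (d * m)))"
proof -
  have "(\<Sum>n=1..N. F n * g n) = (\<Sum>n=1..N. \<Sum>d | d \<in> {1..N} \<and> d dvd n. eratosthenes F d * g n)"
  proof (rule sum.cong[OF refl])
    fix n assume n: "n \<in> {1..N}"
    then have "{d. d \<in> {1..N} \<and> d dvd n} = {d. d dvd n}"
      by (auto dest: dvd_imp_le intro: Suc_leI dvd_pos_nat)
    with n show "F n * g n = (\<Sum>d | d \<in> {1..N} \<and> d dvd n. eratosthenes F d * g n)"
      using sum_eratosthenes[of n F] by (simp flip: sum_distrib_right)
  qed
  also have "\<dots> = (\<Sum>d=1..N. \<Sum>n | n \<in> {1..N} \<and> d dvd n. eratosthenes F d * g n)"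
    by (rule sum.swap_restrict) simp_all
  also have "\<dots> = (\<Sum>d=1..N. eratosthenes F d * (\<Sum>m=1..N div d. g (d * m)))"
  proof (rule sum.cong[OF refl])
    fix d assume "d \<in> {1..N}"
    then have "d > 0"
      by simp
    then have "(\<Sum>n | n \<in> {1..N} \<and> d dvd n. g n) = (\<Sum>m=1..N div d. g (d * m))"
      by (intro sum.reindex_bij_witness[of _ "\<lambda>m. d * m" "\<lambda>n. n div d"])
        (auto simp: less_eq_div_iff_mult_less_eq mult.commute div_le_mono Suc_le_eq
          div_greater_zero_iff dvd_imp_le)
    then show "(\<Sum>n | n \<in> {1..N} \<and> d dvd n. eratosthenes F d * g n)
        = eratosthenes F d * (\<Sum>m=1..N div d. g (d * m))"
      by (simp flip: sum_distrib_left)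
  qed
  finally show ?thesis .
qed

text \<open>The finite sum is written as a series over all \<open>d\<close> so that its range does
  not depend on \<open>N\<close>, the form that Tannery's theorem requires.\<close>

lemma carmichael_mean_of_nat:
  "carmichael_mean F q (real N)
     = (\<Sum>d. eratosthenes F d * of_real ((\<Sum>m=1..N div d. ramanujan_sum q (d * m)) / real N))"
proof -
  have "{n. n > 0 \<and> real n \<le> real N} = {1..N}"
    by auto
  then have "carmichael_mean F q (real N)
      = (\<Sum>n=1..N. F n * of_real (ramanujan_sum q n)) / of_nat N"
    by (simp add: carmichael_mean_def)
  also have "\<dots> = (\<Sum>d=1..N. eratosthenes F d
      * of_real ((\<Sum>m=1..N div d. ramanujan_sum q (d * m)) / real N))"
    unfolding sum_eratosthenes_multiples[of F] sum_divide_distrib[of _ "{1..N}"] by simp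
  also have "\<dots> = (\<Sum>d. eratosthenes F d
      * of_real ((\<Sum>m=1..N div d. ramanujan_sum q (d * m)) / real N))"
    \<comment> \<open>Outside \<open>{1..N}\<close> the inner sum is empty; this includes
      \<open>d = 0\<close>, as \<open>N div 0 = 0\<close>.\<close>
    by (rule suminf_finite[symmetric]) (auto simp: not_le Suc_le_eq)
  finally show ?thesis .
qed

text \<open>The sum sees only the floor of \<open>x\<close>, so just the denominator has to be
  corrected. For \<open>x >= 1\<close> the floor is nonzero and cancels.\<close>

lemma carmichael_mean_nat_floor:
  assumes "x \<ge> 1"
  shows "carmichael_mean F q x
       = carmichael_mean F q (real (nat \<lfloor>x\<rfloor>)) * of_real (real (nat \<lfloor>x\<rfloor>) / x)"
proof -
  define N where "N = nat \<lfloor>x\<rfloor>"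
  have "real n \<le> x \<longleftrightarrow> n \<le> N" for n
    using assms le_nat_floor[of n x] of_nat_floor[of x] of_nat_le_iff[of n N, where ?'a = real]
    unfolding N_def by (meson order_trans zero_le_one)
  moreover have "N \<noteq> 0"
    using assms by (simp add: N_def)
  ultimately show ?thesis
    unfolding N_def[symmetric] by (simp add: carmichael_mean_def)
qed

lemma nat_floor_over_tendsto: "((\<lambda>x. real (nat \<lfloor>x\<rfloor>) / x) \<longlongrightarrow> 1) at_top"
proof (rule tendsto_sandwich)
  show "\<forall>\<^sub>F x in at_top. 1 - 1 / x \<le> real (nat \<lfloor>x\<rfloor>) / x"
    using eventually_ge_at_top[of "1::real"]
  proof eventually_elim
    case (elim x)
    have "(x - 1) / x \<le> real (nat \<lfloor>x\<rfloor>) / x"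
      using elim by (intro divide_right_mono) linarith+
    with elim show ?case
      by (simp add: diff_divide_distrib)
  qed
  show "\<forall>\<^sub>F x in at_top. real (nat \<lfloor>x\<rfloor>) / x \<le> 1"
    using eventually_ge_at_top[of "1::real"]
    by eventually_elim (simp add: divide_le_eq)
  have "((\<lambda>x::real. 1 - 1 / x) \<longlongrightarrow> 1 - 0) at_top"
    by (intro tendsto_intros real_tendsto_divide_at_top[OF tendsto_const filterlim_ident])
  then show "((\<lambda>x::real. 1 - 1 / x) \<longlongrightarrow> 1) at_top"
    by simp
qed simp

section \<open>Carmichael and Wintner coefficients under Wintner's Assumption\<close>

locale wintner_assumption =
  fixes F :: "nat \<Rightarrow> complex"
  assumes wintner: "summable (\<lambda>d. norm (eratosthenes F (Suc d)) / real (Suc d))"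
begin

lemma summable_norm_eratosthenes_over: "summable (\<lambda>d. norm (eratosthenes F d) / real d)"
  using wintner summable_Suc_iff[of "\<lambda>d. norm (eratosthenes F d) / real d"] by simp

lemma summable_wintner_term: "summable (wintner_term F q)"
  by (rule summable_comparison_test'[OF summable_norm_eratosthenes_over, of 0])
    (simp add: wintner_term_def norm_divide)

lemma carmichael_mean_tendsto:
  assumes q: "q > 0"
  shows "(carmichael_mean F q \<longlongrightarrow> of_nat (totient q) * Win F q) at_top"
proof -
  define t where "t = (\<lambda>d N. eratosthenes F d
      * of_real ((\<Sum>m=1..N div d. ramanujan_sum q (d * m)) / real N))"
  \<comment> \<open>The dominating series: at most \<open>N / d\<close> multiples of
    \<open>d\<close> occur, each with a Ramanujan sum bounded by \<open>totient q\<close>, and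
    dividing by \<open>N\<close> removes the dependence on \<open>N\<close>.\<close>
  define M where "M = (\<lambda>d. norm (eratosthenes F d) / real d * real (totient q))"
  have lim: "(\<lambda>N. t d N) \<longlonglongrightarrow> of_nat (totient q) * wintner_term F q d" for d
  proof (cases "d = 0")
    case True
    then show ?thesis
      by (simp add: t_def wintner_term_def)
  next
    case False
    then have "(\<lambda>N. t d N) \<longlonglongrightarrow> eratosthenes F d
        * of_real (if q dvd d then real (totient q) / real d else 0)"
      unfolding t_def
      by (intro tendsto_mult tendsto_const tendsto_of_real mean_ramanujan_sum_multiples_tendsto q)
        simp
    with False show ?thesis
      by (auto simp: wintner_term_def mult_ac split: if_splits)
  qed
  have bound: "norm (t d N) \<le> M d" for d N
  proof (cases "d = 0 \<or> N = 0")
    case True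
    then show ?thesis
      by (auto simp: t_def M_def)
  next
    case False
    have "\<bar>\<Sum>m=1..N div d. ramanujan_sum q (d * m)\<bar> \<le> (\<Sum>m=1..N div d. real (totient q))"
      by (rule order_trans[OF sum_abs]) (intro sum_mono abs_ramanujan_sum_le)
    also have "\<dots> = real (N div d) * real (totient q)"
      by simp
    also have "\<dots> \<le> real N / real d * real (totient q)"
      by (intro mult_right_mono of_nat_div_le_of_nat) simp
    finally have "\<bar>(\<Sum>m=1..N div d. ramanujan_sum q (d * m)) / real N\<bar>
        \<le> (real N / real d * real (totient q)) / real N"
      unfolding abs_divide abs_of_nat by (rule divide_right_mono) simp
    also have "\<dots> = real (totient q) / real d"
      using False by simp
    finally have "norm (t d N) \<le> norm (eratosthenes F d) * (real (totient q) / real d)"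
      unfolding t_def norm_mult norm_of_real by (rule mult_left_mono) simp
    then show ?thesis
      by (simp add: M_def mult_ac)
  qed
  have "summable M"
    unfolding M_def by (intro summable_mult2 summable_norm_eratosthenes_over)
  with lim bound have "(\<lambda>N. \<Sum>d. t d N) \<longlonglongrightarrow> (\<Sum>d. of_nat (totient q) * wintner_term F q d)"
    by (intro tannerys_theorem[where M = M, THEN conjunct2, THEN conjunct2])
      (auto intro: always_eventually)
  then have "(\<lambda>N. carmichael_mean F q (real N)) \<longlonglongrightarrow> of_nat (totient q) * Win F q"
    unfolding t_def carmichael_mean_of_nat[symmetric]
    by (simp add: Win_def suminf_mult summable_wintner_term)
  then have "((\<lambda>x. carmichael_mean F q (real (nat \<lfloor>x\<rfloor>)))
      \<longlongrightarrow> of_nat (totient q) * Win F q) at_top"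
    by (rule filterlim_compose)
      (rule filterlim_compose[OF filterlim_nat_sequentially filterlim_floor_sequentially])
  \<comment> \<open>The limit is known along the integers; the factor \<open>floor x / x\<close>,
    tending to 1, carries it over to real \<open>x\<close>.\<close>
  then have "((\<lambda>x. carmichael_mean F q (real (nat \<lfloor>x\<rfloor>)) * of_real (real (nat \<lfloor>x\<rfloor>) / x))
      \<longlongrightarrow> of_nat (totient q) * Win F q * of_real 1) at_top"
    by (intro tendsto_mult tendsto_of_real nat_floor_over_tendsto)
  moreover have "\<forall>\<^sub>F x in at_top. carmichael_mean F q (real (nat \<lfloor>x\<rfloor>))
      * of_real (real (nat \<lfloor>x\<rfloor>) / x) = carmichael_mean F q x"
    using eventually_ge_at_top[of "1::real"]
    by eventually_elim (simp only: carmichael_mean_nat_floor[symmetric])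
  ultimately show ?thesis
    by (simp add: tendsto_cong)
qed

text \<open>For positive \<open>q\<close> this is the limit just found, divided by the nonzero
  \<open>totient q\<close>. At \<open>q = 0\<close> both sides default to 0, so the functions agree
  everywhere and one may be rewritten into the other.\<close>

lemma Car_eq_Win: "Car F = Win F"
proof
  fix q
  show "Car F q = Win F q"
  proof (cases "q = 0")
    case True
    have "wintner_term F 0 = (\<lambda>_. 0)"
      by (auto simp: wintner_term_def)
    with True show ?thesis
      by (simp add: Car_def Win_def)
  next
    case False
    then have "Lim at_top (carmichael_mean F q) = of_nat (totient q) * Win F q"
      by (intro tendsto_Lim carmichael_mean_tendsto) simp_all
    with False show ?thesis
      by (simp add: Car_def)
  qed
qed

section \<open>Smooth partial sums of the Ramanujan expansion\<close>

lemma has_sum_Win_ramanujan_sum_smooth: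
  assumes "a > 0"
  shows "((\<lambda>q. Win F q * of_real (ramanujan_sum q a)) has_sum
    (\<Sum>d. eratosthenes F d / of_nat d
         * of_real (\<Sum>q | q \<in> smooth_numbers V \<and> q dvd d. ramanujan_sum q a))) (smooth_numbers V)"
proof -
  \<comment> \<open>Only the finitely many \<open>q\<close> in \<open>K\<close> contribute, so the
    sum over \<open>q\<close> can be exchanged with the series over \<open>d\<close>
    termwise.\<close>
  define K where "K = {q \<in> smooth_numbers V. ramanujan_sum q a \<noteq> 0}"
  have fin: "finite K"
    unfolding K_def by (rule finite_smooth_ramanujan_sum_nonzero[OF assms])
  have "(\<Sum>q\<in>K. Win F q * of_real (ramanujan_sum q a))
      = (\<Sum>q\<in>K. \<Sum>d. wintner_term F q d * of_real (ramanujan_sum q a))"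
    unfolding Win_def by (simp add: suminf_mult2[OF summable_wintner_term])
  also have "\<dots> = (\<Sum>d. \<Sum>q\<in>K. wintner_term F q d * of_real (ramanujan_sum q a))"
    by (rule suminf_sum[symmetric]) (intro summable_mult2 summable_wintner_term)
  also have "\<dots> = (\<Sum>d. eratosthenes F d / of_nat d
         * of_real (\<Sum>q | q \<in> smooth_numbers V \<and> q dvd d. ramanujan_sum q a))"
  proof (rule suminf_cong)
    fix d
    show "(\<Sum>q\<in>K. wintner_term F q d * of_real (ramanujan_sum q a)) = eratosthenes F d / of_nat d
         * of_real (\<Sum>q | q \<in> smooth_numbers V \<and> q dvd d. ramanujan_sum q a)"
    proof (cases "d = 0")
      case True
      then show ?thesis
        by (simp add: wintner_term_def)
    next
      case False
      have "(\<Sum>q\<in>K. wintner_term F q d * of_real (ramanujan_sum q a))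
          = (\<Sum>q | q \<in> K \<and> q dvd d. eratosthenes F d / of_nat d * of_real (ramanujan_sum q a))"
        using fin False by (intro sum.mono_neutral_cong_right) (auto simp: wintner_term_def)
      also have "\<dots> = eratosthenes F d / of_nat d * of_real (\<Sum>q | q \<in> K \<and> q dvd d. ramanujan_sum q a)"
        by (simp add: sum_distrib_left)
      \<comment> \<open>The indices with vanishing Ramanujan sum are put back; finiteness now comes
        from \<open>q\<close> dividing the nonzero \<open>d\<close>.\<close>
      also have "(\<Sum>q | q \<in> K \<and> q dvd d. ramanujan_sum q a)
          = (\<Sum>q | q \<in> smooth_numbers V \<and> q dvd d. ramanujan_sum q a)"
        using False
        by (intro sum.mono_neutral_left finite_subset[OF _ finite_divisors_nat[of d]])
          (auto simp: K_def)
      finally show ?thesis .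
    qed
  qed
  finally have "((\<lambda>q. Win F q * of_real (ramanujan_sum q a)) has_sum
    (\<Sum>d. eratosthenes F d / of_nat d
         * of_real (\<Sum>q | q \<in> smooth_numbers V \<and> q dvd d. ramanujan_sum q a))) K"
    using fin by (simp add: has_sum_finiteI)
  then show ?thesis
    by (rule has_sum_cong_neutral[THEN iffD1, rotated -1]) (auto simp: K_def)
qed

lemma infsum_Win_ramanujan_sum_smooth_tendsto:
  assumes a: "a > 0"
  shows "(\<lambda>V. \<Sum>\<^sub>\<infinity>q\<in>smooth_numbers V. Win F q * of_real (ramanujan_sum q a)) \<longlonglongrightarrow> F a"
proof -
  define t where "t = (\<lambda>d V. eratosthenes F d / of_nat d
         * of_real (\<Sum>q | q \<in> smooth_numbers V \<and> q dvd d. ramanujan_sum q a))"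
  define M where "M = (\<lambda>d. norm (eratosthenes F d) / real d * real a)"
  define l where "l = (\<lambda>d. if d dvd a then eratosthenes F d else 0)"
  have lim: "(\<lambda>V. t d V) \<longlonglongrightarrow> l d" for d
  proof (cases "d = 0")
    case True
    with a show ?thesis
      by (simp add: t_def l_def)
  next
    case False
    \<comment> \<open>Once \<open>V >= d\<close>, the inner sum is \<open>d\<close> or 0, and the
      \<open>d\<close> cancels the denominator.\<close>
    have "\<forall>\<^sub>F V in sequentially. t d V = l d"
      using eventually_ge_at_top[of d]
      by eventually_elim (use False in \<open>simp add: t_def l_def sum_smooth_ramanujan_sum_eq del: of_real_sum\<close>)
    then show ?thesis
      by (rule tendsto_eventually)
  qed
  have bound: "norm (t d V) \<le> M d" for d V
  proof (cases "d = 0")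
    case True
    then show ?thesis
      by (simp add: t_def M_def)
  next
    case False
    then show ?thesis
      unfolding t_def M_def norm_mult norm_divide norm_of_real norm_of_nat
      by (intro mult_left_mono norm_sum_smooth_ramanujan_sum_le) (use a in auto)
  qed
  have "summable M"
    unfolding M_def by (intro summable_mult2 summable_norm_eratosthenes_over)
  with lim bound have "(\<lambda>V. \<Sum>d. t d V) \<longlonglongrightarrow> (\<Sum>d. l d)"
    by (intro tannerys_theorem[where M = M, THEN conjunct2, THEN conjunct2])
      (auto intro: always_eventually)
  moreover have "(\<Sum>d. l d) = (\<Sum>d | d dvd a. l d)"
    using a by (intro suminf_finite) (auto simp: l_def finite_divisors_nat)
  moreover have "(\<Sum>d | d dvd a. l d) = F a"
    using sum_eratosthenes[OF a, of F] by (simp add: l_def)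
  ultimately show ?thesis
    unfolding t_def using infsumI[OF has_sum_Win_ramanujan_sum_smooth[OF a]] by simp
qed

text \<open>The coefficients vanish off \<open>S\<close>, so for every \<open>V >= V\<^sub>0\<close>
  the smooth sum equals the sum over \<open>S\<close>. A sequence that is eventually constant has
  that constant as its limit, which is \<open>F a\<close>. The free choice of \<open>S\<close>
  covers both support conditions.\<close>

lemma has_sum_Win_ramanujan_sum_support:
  assumes a: "a > 0" and S: "S \<subseteq> smooth_numbers V\<^sub>0"
    and zero: "\<And>q. q > 0 \<Longrightarrow> q \<notin> S \<Longrightarrow> Win F q = 0"
  shows "((\<lambda>q. Win F q * of_real (ramanujan_sum q a)) has_sum F a) S"
proof -
  let ?f = "\<lambda>q. Win F q * of_real (ramanujan_sum q a)"
  have eq: "(?f has_sum s) (smooth_numbers V) \<longleftrightarrow> (?f has_sum s) S" if "V \<ge> V\<^sub>0" for s V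
  proof (rule has_sum_cong_neutral)
    have "smooth_numbers V\<^sub>0 \<subseteq> smooth_numbers V"
      using that by (auto simp: smooth_numbers_def intro: order_trans)
    with S show "?f q = 0" if "q \<in> S - smooth_numbers V" for q
      using that by blast
  qed (use zero in \<open>auto simp: smooth_numbers_def\<close>)
  have "(?f has_sum infsum ?f S) S"
    using has_sum_Win_ramanujan_sum_smooth[OF a, of V\<^sub>0] eq[OF order_refl]
    by (blast intro: has_sum_infsum has_sum_imp_summable)
  moreover from this have "infsum ?f (smooth_numbers V) = infsum ?f S" if "V \<ge> V\<^sub>0" for V
    using eq[OF that] by (intro infsumI) blast
  then have "\<forall>\<^sub>F V in sequentially. infsum ?f (smooth_numbers V) = infsum ?f S"
    by (rule eventually_sequentiallyI)
  then have "(\<lambda>V. infsum ?f (smooth_numbers V)) \<longlonglongrightarrow> infsum ?f S"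
    by (rule tendsto_eventually)
  then have "infsum ?f S = F a"
    using infsum_Win_ramanujan_sum_smooth_tendsto[OF a] LIMSEQ_unique by blast
  ultimately show ?thesis
    by simp
qed

end

theorem theorem1:
  fixes F :: "nat \<Rightarrow> complex"
  assumes wintner: "summable (\<lambda>d. norm (eratosthenes F (Suc d)) / real (Suc d))"
  shows
    "(\<forall>q\<ge>1. summable (wintner_term F q) \<and>
        (\<exists>L. (carmichael_mean F q \<longlongrightarrow> L) at_top)) \<and>
     (\<forall>a\<ge>1.
        (\<forall>P. prime P \<longrightarrow>
           (\<lambda>q. Win F q * of_real (ramanujan_sum q a)) summable_on smooth_numbers P \<and>
           (\<lambda>q. Car F q * of_real (ramanujan_sum q a)) summable_on smooth_numbers P) \<and>
        ((\<lambda>P. \<Sum>\<^sub>\<infinity>q\<in>smooth_numbers P. Win F q * of_real (ramanujan_sum q a))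
           \<longlongrightarrow> F a) primes_at_top \<and>
        ((\<lambda>P. \<Sum>\<^sub>\<infinity>q\<in>smooth_numbers P. Car F q * of_real (ramanujan_sum q a))
           \<longlongrightarrow> F a) primes_at_top) \<and>
     (\<forall>Q. prime Q \<longrightarrow> support (Win F) \<subseteq> smooth_numbers Q \<longrightarrow>
        (\<forall>a\<ge>1.
           ((\<lambda>q. Win F q * of_real (ramanujan_sum q a)) has_sum F a) (smooth_numbers Q) \<and>
           ((\<lambda>q. Car F q * of_real (ramanujan_sum q a)) has_sum F a) (smooth_numbers Q))) \<and>
     (\<forall>Q\<ge>1. (\<forall>q>Q. Win F q = 0) \<longrightarrow>
        (\<forall>a\<ge>1.
           F a = (\<Sum>q=1..Q. Win F q * of_real (ramanujan_sum q a)) \<and>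
           F a = (\<Sum>q=1..Q. Car F q * of_real (ramanujan_sum q a))))"
proof -
  interpret wintner_assumption F
    by unfold_locales (rule wintner)
  have lim: "((\<lambda>P. \<Sum>\<^sub>\<infinity>q\<in>smooth_numbers P. Win F q * of_real (ramanujan_sum q a))
      \<longlongrightarrow> F a) primes_at_top" if "a \<ge> 1" for a
    \<comment> \<open>The limit holds along all natural \<open>V\<close>, and
      \<open>primes_at_top\<close> is a finer filter.\<close>
    by (rule tendsto_mono[OF _ infsum_Win_ramanujan_sum_smooth_tendsto])
      (use that in \<open>simp_all add: primes_at_top_def\<close>)
  have smooth: "((\<lambda>q. Win F q * of_real (ramanujan_sum q a)) has_sum F a) (smooth_numbers Q)"
    if "support (Win F) \<subseteq> smooth_numbers Q" "a \<ge> 1" for a Q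
    by (rule has_sum_Win_ramanujan_sum_support[where V\<^sub>0 = Q])
      (use that in \<open>auto simp: support_def\<close>)
  have initial: "F a = (\<Sum>q=1..Q. Win F q * of_real (ramanujan_sum q a))"
    if "\<forall>q>Q. Win F q = 0" "a \<ge> 1" for a Q
  proof -
    \<comment> \<open>Here \<open>S\<close> is \<open>{1..Q}\<close>, whose elements are
      \<open>Q\<close>-smooth because a prime factor never exceeds the number.\<close>
    have "((\<lambda>q. Win F q * of_real (ramanujan_sum q a)) has_sum F a) {1..Q}"
      by (rule has_sum_Win_ramanujan_sum_support[where V\<^sub>0 = Q])
        (use that in \<open>auto simp: smooth_numbers_def dest: dvd_imp_le\<close>)
    then show ?thesis
      by (simp add: has_sum_finite_iff)
  qed
  show ?thesis
    unfolding Car_eq_Win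
    using summable_wintner_term carmichael_mean_tendsto lim smooth initial
      has_sum_imp_summable[OF has_sum_Win_ramanujan_sum_smooth]
    by (auto simp: Suc_le_eq intro!: exI)
qed

end
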